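(* Let $(X,*,0)$ be a BCK-algebra or a BCI-algebra and let $\|\cdot\|_f : X\times(0,\infty)\to[0,1]$ be a fuzzy BCK/BCI-norm on $X$. Then: (c1) For each $x\in X$, the mapping $t\mapsto\|(x,t)\|_f$ is non-decreasing on $(0,\infty)$. (c2) For every $t\in(0,\infty)$, every integer $n\ge2$ (so that $t=\tfrac{t}{n}+\tfrac{(n-1)t}{n}$), and all $x,y\in X$: if $x\le y$, then $\|(x,t)\|_f\ge\left\|\left(y,\tfrac{(n-1)t}{n}\right)\right\|_f$.
   Context: A BCI-algebra is a set $X$ with a binary operation $*$ and a distinguished element $0$ such that for all $a,b,c\in X$: (I1) $((a*b)*(a*c))*(c*b)=0$; (I2) $(a*(a*b))*b=0$; (I3) $a*a=0$; (I4) $a*b=0$ and $b*a=0$ imply $a=b$. A BCK-algebra is a BCI-algebra that also satisfies (K): $0*a=0$ for all $a\in X$. The order relation on $X$ is defined by $a\le b$ if and only if $a*b=0$. For a BCK-algebra or BCI-algebra $(X,*,0)$, a fuzzy BCK/BCI-norm on $X$ is a mapping $\|\cdot\|_f : X\times(0,\infty)\to[0,1]$, with values written $\|(x,t)\|_f$, satisfying for all $x,y,z\in X$ and $s,t\in(0,\infty)$: (FN1) $\|(x,t)\|_f=1$ if and only if $x=0$; (FN2) if $t\ge s$ then $\|(x,t)\|_f\ge\|(x,s)\|_f$; (FN3) $\lim_{t\to\infty}\|(x,t)\|_f=1$; (FN4) $\|(x*z,s+t)\|_f\ge\min\{\|(x*y,s)\|_f,\|(y*z,t)\|_f\}$. 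*)

theory Defs
  imports Complex_Main
begin

locale bci_algebra =
  fixes X :: "'a set"
    and star :: "'a \<Rightarrow> 'a \<Rightarrow> 'a"  (infixl \<open>\<star>\<close> 70)
    and zero :: 'a  (\<open>\<zero>\<close>)
  assumes star_closed: "a \<in> X \<Longrightarrow> b \<in> X \<Longrightarrow> a \<star> b \<in> X"
    and zero_closed: "\<zero> \<in> X"
    and I1: "a \<in> X \<Longrightarrow> b \<in> X \<Longrightarrow> c \<in> X \<Longrightarrow> ((a \<star> b) \<star> (a \<star> c)) \<star> (c \<star> b) = \<zero>"
    and I2: "a \<in> X \<Longrightarrow> b \<in> X \<Longrightarrow> (a \<star> (a \<star> b)) \<star> b = \<zero>"
    and I3: "a \<in> X \<Longrightarrow> a \<star> a = \<zero>"
    and I4: "a \<in> X \<Longrightarrow> b \<in> X \<Longrightarrow> a \<star> b = \<zero> \<Longrightarrow> b \<star> a = \<zero> \<Longrightarrow> a = b"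

locale bck_algebra = bci_algebra +
  assumes K: "a \<in> X \<Longrightarrow> \<zero> \<star> a = \<zero>"

definition bci_le :: "('a \<Rightarrow> 'a \<Rightarrow> 'a) \<Rightarrow> 'a \<Rightarrow> 'a \<Rightarrow> 'a \<Rightarrow> bool" where
  "bci_le star zero a b \<longleftrightarrow> star a b = zero"

text \<open>Only the values of \<open>N\<close> on \<open>X \<times> {0<..}\<close> are constrained; elsewhere \<open>N\<close> is arbitrary.
  The algebra axioms on \<open>(X, star, zero)\<close> are deliberately not part of this locale, so that it
  applies to BCK- and BCI-algebras alike.\<close>

locale fuzzy_bck_bci_norm =
  fixes X :: "'a set"
    and star :: "'a \<Rightarrow> 'a \<Rightarrow> 'a"  (infixl \<open>\<star>\<close> 70)
    and zero :: 'a  (\<open>\<zero>\<close>)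
    and N :: "'a \<times> real \<Rightarrow> real"
  assumes range: "x \<in> X \<Longrightarrow> t > 0 \<Longrightarrow> N (x, t) \<in> {0..1}"
    and FN1: "x \<in> X \<Longrightarrow> t > 0 \<Longrightarrow> N (x, t) = 1 \<longleftrightarrow> x = \<zero>"
    and FN2: "x \<in> X \<Longrightarrow> s > 0 \<Longrightarrow> t > 0 \<Longrightarrow> t \<ge> s \<Longrightarrow> N (x, t) \<ge> N (x, s)"
    and FN3: "x \<in> X \<Longrightarrow> ((\<lambda>t. N (x, t)) \<longlongrightarrow> 1) at_top"
    and FN4: "x \<in> X \<Longrightarrow> y \<in> X \<Longrightarrow> z \<in> X \<Longrightarrow> s > 0 \<Longrightarrow> t > 0 \<Longrightarrow>
                N (x \<star> z, s + t) \<ge> min (N (x \<star> y, s)) (N (y \<star> z, t))"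

end

theory Submission
  imports Defs
begin

text \<open>Monotonicity in \<open>t\<close> is (FN2). For the comparison, \<open>x * 0 = x\<close> holds in every BCI-algebra, so
  (FN4) at the triple \<open>x, y, 0\<close> bounds \<open>N (x, s + t)\<close> below by the minimum of \<open>N (x * y, s)\<close> and
  \<open>N (y, t)\<close>, and the first of these is 1 when \<open>x * y = 0\<close>.\<close>

context bci_algebra
begin

text \<open>(I1) at \<open>a, a, 0\<close> collapses to 0 * (0 * a) = 0, so (I2) at
  \<open>0, a\<close> reduces to 0 * a = 0, and antisymmetry (I4) applies.\<close>

lemma star_zero_eq_zeroD:
  assumes a: "a \<in> X" and a0: "a \<star> \<zero> = \<zero>"
  shows "a = \<zero>"
proof -
  have "\<zero> \<star> (\<zero> \<star> a) = \<zero>"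
    using I1[OF a a zero_closed] a0 I3[OF a] I3[OF zero_closed] by simp
  then have "\<zero> \<star> a = \<zero>"
    using I2[OF zero_closed a] by simp
  then show ?thesis
    using I4[OF a zero_closed a0] by simp
qed

lemma star_zero_right:
  assumes x: "x \<in> X"
  shows "x \<star> \<zero> = x"
proof (rule I4)
  show "(x \<star> \<zero>) \<star> x = \<zero>"
    using I2[OF x x] I3[OF x] by simp
  \<comment> \<open>(I2) at \<open>x, 0\<close> has a trailing 0 on the right, which the preceding
    lemma strips off.\<close>
  show "x \<star> (x \<star> \<zero>) = \<zero>"
    using I2[OF x zero_closed] x by (simp add: star_zero_eq_zeroD star_closed zero_closed)
qed (use x in \<open>auto intro: star_closed zero_closed\<close>)

end

lemma fuzzy_norm_add_ge:
  assumes "bci_algebra X star zero" "fuzzy_bck_bci_norm X star zero N"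
    and x: "x \<in> X" and y: "y \<in> X" and le: "bci_le star zero x y"
    and s: "s > 0" and t: "t > 0"
  shows "N (x, s + t) \<ge> N (y, t)"
proof -
  interpret bci_algebra X star zero by fact
  interpret fuzzy_bck_bci_norm X star zero N by fact
  have "N (star x y, s) = 1"
    using le FN1[OF zero_closed s] by (simp add: bci_le_def)
  then have "min 1 (N (y, t)) \<le> N (x, s + t)"
    using FN4[OF x y zero_closed s t] star_zero_right x y by simp
  \<comment> \<open>The norm is at most 1, so the minimum is N (y, t).\<close>
  then show ?thesis
    using range[OF y t] by simp
qed

theorem proposition3p10:
  fixes X :: "'a set"
    and star :: "'a \<Rightarrow> 'a \<Rightarrow> 'a"
    and zero :: 'a
    and N :: "'a \<times> real \<Rightarrow> real"
  assumes "bck_algebra X star zero \<or> bci_algebra X star zero"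
    and "fuzzy_bck_bci_norm X star zero N"
  shows "(\<forall>x\<in>X. mono_on {0<..} (\<lambda>t. N (x, t))) \<and>
         (\<forall>t>0. \<forall>n::int. n \<ge> 2 \<longrightarrow> (\<forall>x\<in>X. \<forall>y\<in>X. bci_le star zero x y \<longrightarrow>
            N (x, t) \<ge> N (y, (of_int n - 1) * t / of_int n)))"
proof -
  interpret fuzzy_bck_bci_norm X star zero N by fact
  have alg: "bci_algebra X star zero"
    using assms(1) by (auto dest: bck_algebra.axioms(1))
  have "mono_on {0<..} (\<lambda>t. N (x, t))" if "x \<in> X" for x
    using FN2[OF that] by (auto intro: mono_onI)
  moreover have "N (x, t) \<ge> N (y, (of_int n - 1) * t / of_int n)"
    if t: "t > 0" and n: "n \<ge> 2" and xy: "x \<in> X" "y \<in> X" "bci_le star zero x y"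
    for t :: real and n :: int and x y
  proof -
    have "t / of_int n + (of_int n - 1) * t / of_int n = t"
      using n by (simp add: field_simps)
    \<comment> \<open>For n = 1 the second summand would be 0, outside the domain of the norm; n
      \<ge> 2 keeps both parts positive.\<close>
    moreover have "t / of_int n > 0" "(of_int n - 1) * t / of_int n > 0"
      using t n by simp_all
    ultimately show ?thesis
      using fuzzy_norm_add_ge[OF alg assms(2) xy] by metis
  qed
  ultimately show ?thesis by blast
qed

end
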